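(* Let $k$ and $n$ be positive even integers. Among the $2^{k+n}$ assignments of over/under data to the crossings of the free $k\ n$ knot diagram, exactly $$2^k\binom{n}{\frac n2}+2^n\binom{k}{\frac k2}-\binom{n}{\frac n2}\binom{k}{\frac k2}$$ produce the unknot.
   Context: The free $k\ n$ knot diagram is the following planar closed curve with $k+n$ double points (the free closure of Conway's $k\ n$ tangle). Take a horizontal row of $n$ crossings: two parallel horizontal strands crossing each other $n$ times in succession, with four ends (upper-left, lower-left, upper-right, lower-right). Above it place a vertical column of $k$ crossings: two parallel vertical strands crossing each other $k$ times in succession, with four ends (upper-left, upper-right, lower-left, lower-right). Join the lower-left end of the column to the upper-left end of the row, the lower-right end of the column to the upper-right end of the row, the upper-left end of the column to the lower-left end of the row (by an arc around the left side), and the upper-right end of the column to the lower-right end of the row (by an arc around the right side), without creating further crossings. When at least one of $k$, $n$ is even this is a single closed curve. An assignment is a choice, at each crossing, of which of the two strands is the overstrand; it produces a knot diagram. *)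

theory Defs
  imports Main "HOL-Library.FuncSet"
begin

section \<open>Planar diagrams\<close>

text \<open>
  A link diagram in the plane, in general position with respect to the vertical coordinate, is
  written as the list of its critical levels from top to bottom.  Each level carries exactly one
  local maximum, local minimum or crossing; between two levels the picture consists of disjoint
  descending strands, numbered from left to right starting from 0.  The entry \<open>(i, p)\<close> is
  the piece \<open>p\<close> with exactly \<open>i\<close> strands to its left:

  \<^item> \<open>Cap\<close>, a local maximum, creates two adjacent strands \<open>i\<close>, \<open>i + 1\<close>;
  \<^item> \<open>Cup\<close>, a local minimum, joins the strands \<open>i\<close>, \<open>i + 1\<close> and ends both;
  \<^item> \<open>Cross c\<close> is a transversal double point of the strands \<open>i\<close>, \<open>i + 1\<close>.

  The label \<open>c\<close> is a name of the double point in the case of a closed curve without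
  over/under data, and the overstrand in the case of a link diagram.
\<close>

datatype 'c piece = Cap | Cup | Cross 'c

type_synonym 'c diagram = "(nat \<times> 'c piece) list"

fun ins :: "'c piece \<Rightarrow> nat" where
  "ins Cap = 0" | "ins Cup = 2" | "ins (Cross c) = 2"

fun outs :: "'c piece \<Rightarrow> nat" where
  "outs Cap = 2" | "outs Cup = 0" | "outs (Cross c) = 2"

text \<open>The number of strands below the diagram, if there are \<open>N\<close> above it and every
  piece finds the strands it needs.\<close>

fun strands_below :: "nat \<Rightarrow> 'c diagram \<Rightarrow> nat option" where
  "strands_below N [] = Some N"
| "strands_below N ((i, p) # D) =
     (if i + ins p \<le> N then strands_below (N - ins p + outs p) D else None)"

definition closed_diagram :: "'c diagram \<Rightarrow> bool" where
  "closed_diagram D \<longleftrightarrow> strands_below 0 D = Some 0"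

text \<open>At a crossing, \<open>Falling\<close> is the strand running from the upper left to the lower
  right, \<open>Rising\<close> the one running from the lower left to the upper right.\<close>

datatype strand = Falling | Rising

fun other :: "strand \<Rightarrow> strand" where
  "other Falling = Rising" | "other Rising = Falling"

type_synonym link_diagram = "strand diagram"  \<comment> \<open>\<open>Cross s\<close>: the strand \<open>s\<close> is over\<close>

definition crossings :: "'c diagram \<Rightarrow> 'c set" where
  "crossings S = (\<Union>(i, p) \<in> set S. set_piece p)"

definition assignments :: "'c diagram \<Rightarrow> ('c \<Rightarrow> strand) set" where
  "assignments S = crossings S \<rightarrow>\<^sub>E UNIV"

definition resolve :: "('c \<Rightarrow> strand) \<Rightarrow> 'c diagram \<Rightarrow> link_diagram" where
  "resolve a S = map (\<lambda>(i, p). (i, map_piece a p)) S"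


section \<open>Equivalence of link diagrams and the unknot\<close>

text \<open>
  Planar isotopy in this setting is generated by exchanging the heights of two pieces that lie
  side by side, cancelling a maximum against an adjacent minimum, and rotating a crossing past a
  maximum or a minimum.  In the last case the two strands at the crossing exchange
  their roles (falling/rising), so the label of the crossing changes although the overstrand does
  not.  Together with the three Reidemeister moves, in one position each, these generate the
  Reidemeister moves in all positions (the usual unoriented tangle moves of Freyd--Yetter, Turaev
  and Kauffman).
\<close>

inductive local_move :: "link_diagram \<Rightarrow> link_diagram \<Rightarrow> bool" where
  exchange: "local_move [(i + ins p + m, q), (i, p)] [(i, p), (i + outs p + m, q)]"
| zigzag_left: "local_move [(i, Cap), (i + 1, Cup)] []"
| zigzag_right: "local_move [(i + 1, Cap), (i, Cup)] []"
| rotate_cap: "local_move [(i, Cap), (i + 1, Cross s)] [(i + 1, Cap), (i, Cross (other s))]"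
| rotate_cup: "local_move [(i, Cross s), (i + 1, Cup)] [(i + 1, Cross (other s)), (i, Cup)]"
| R1_cap: "local_move [(i, Cap), (i, Cross s)] [(i, Cap)]"
| R1_cup: "local_move [(i, Cross s), (i, Cup)] [(i, Cup)]"
| R2: "local_move [(i, Cross s), (i, Cross (other s))] []"
| R3: "local_move [(i, Cross r), (i + 1, Cross s), (i, Cross t)]
                  [(i + 1, Cross t), (i, Cross s), (i + 1, Cross r)]"
    if "s = r \<or> s = t"
    \<comment> \<open>\<open>r\<close>, \<open>s\<close>, \<open>t\<close> belong to the pairs of strands 12, 13, 23; the condition excludes
      exactly the two cyclic patterns, in which no strand lies above the two others\<close>

definition move :: "link_diagram \<Rightarrow> link_diagram \<Rightarrow> bool" where
  "move D E \<longleftrightarrow> closed_diagram D \<and> closed_diagram E \<and>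
     (\<exists>U L R V. local_move L R \<and> D = U @ L @ V \<and> E = U @ R @ V)"

abbreviation diagram_equiv :: "link_diagram \<Rightarrow> link_diagram \<Rightarrow> bool" where
  "diagram_equiv \<equiv> equivclp move"

definition circle :: link_diagram where
  "circle = [(0, Cap), (0, Cup)]"

definition is_unknot :: "link_diagram \<Rightarrow> bool" where
  "is_unknot D \<longleftrightarrow> closed_diagram D \<and> diagram_equiv D circle"


section \<open>The free k n knot diagram\<close>

datatype crossing = Column nat | Row nat

text \<open>
  The first two caps are the upper halves of the arcs around the left and the right side: their
  legs 0 and 3 are those arcs, their legs 1 and 2 are the upper ends of the column.  After the
  column, strands 1 and 2 are its lower ends.  The next \<open>n - 1\<close> caps join the upper right end
  of each crossing of the row to the upper left end of its successor, so that the \<open>j\<close>-th crossing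
  of the row occupies the strands \<open>2 * j + 1\<close>, \<open>2 * j + 2\<close> and the extreme upper ends of the row
  continue the column.  The following \<open>n - 1\<close> cups join lower right to lower left ends in the
  same way, and the last two cups join the extreme lower ends of the row to the arcs.
\<close>

definition free_diagram :: "nat \<Rightarrow> nat \<Rightarrow> crossing diagram" where
  "free_diagram k n =
     [(0, Cap), (2, Cap)]
     @ map (\<lambda>i. (1, Cross (Column i))) [0..<k]
     @ replicate (n - 1) (2, Cap)
     @ map (\<lambda>j. (2 * j + 1, Cross (Row j))) [0..<n]
     @ replicate (n - 1) (2, Cup)
     @ [(0, Cup), (0, Cup)]"

lemma strands_below_append:
  "strands_below N (D @ E) =
     (case strands_below N D of None \<Rightarrow> None | Some M \<Rightarrow> strands_below M E)"
  by (induction N D rule: strands_below.induct) auto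

lemma strands_below_crosses:
  "(\<And>i. i \<in> set js \<Longrightarrow> f i + 2 \<le> N) \<Longrightarrow>
   strands_below N (map (\<lambda>i. (f i, Cross (g i))) js) = Some N"
proof (induction js)
  case (Cons i js)
  have "f i + 2 \<le> N"
    using Cons.prems by simp
  then obtain M where "N = M + 2"
    by (metis add.commute add_leD2 le_Suc_ex)
  with Cons show ?case
    by simp
qed simp

lemma strands_below_caps: "2 \<le> N \<Longrightarrow> strands_below N (replicate m (2, Cap)) = Some (N + 2 * m)"
  by (induction m arbitrary: N) auto

lemma strands_below_cups: "strands_below (4 + 2 * m) (replicate m (2, Cup)) = Some 4"
  by (induction m) auto

lemma closed_free_diagram:
  assumes "n > 0"
  shows "closed_diagram (free_diagram k n)"
proof -
  have col: "strands_below 4 (map (\<lambda>i. (1, Cross (Column i))) [0..<k]) = Some 4"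
    by (rule strands_below_crosses) simp
  have row: "strands_below (4 + 2 * (n - 1)) (map (\<lambda>j. (2 * j + 1, Cross (Row j))) [0..<n])
      = Some (4 + 2 * (n - 1))"
    using assms by (intro strands_below_crosses) auto
  have caps: "strands_below 4 (replicate (n - 1) (2, Cap)) = Some (4 + 2 * (n - 1))"
    by (rule strands_below_caps) simp
  have start: "strands_below 0 [(0, Cap), (2, Cap)] = Some 4"
    and finish: "strands_below 4 [(0, Cup), (0, Cup)] = Some 0"
    by simp_all
  show ?thesis
    unfolding closed_diagram_def free_diagram_def
    by (simp only: strands_below_append start col caps row strands_below_cups finish option.case)
qed

lemma strands_below_resolve: "strands_below N (resolve a S) = strands_below N S"
proof -
  have "ins (map_piece a p) = ins p" "outs (map_piece a p) = outs p" for p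
    by (cases p; simp)+
  then show ?thesis
    by (induction N S rule: strands_below.induct) (auto simp: resolve_def)
qed

lemma closed_resolve: "closed_diagram (resolve a S) \<longleftrightarrow> closed_diagram S"
  by (simp add: closed_diagram_def strands_below_resolve)

lemma crossings_free_diagram:
  "crossings (free_diagram k n) = Column ` {..<k} \<union> Row ` {..<n}"
  by (auto simp: crossings_def free_diagram_def)

lemma card_assignments_free_diagram: "card (assignments (free_diagram k n)) = 2 ^ (k + n)"
proof -
  have "(UNIV :: strand set) = {Falling, Rising}"
    using strand.exhaust by auto
  then have "card (UNIV :: strand set) = card {Falling, Rising}"
    by (rule arg_cong)
  then have "card (UNIV :: strand set) = 2"
    by simp
  moreover have "card (Column ` {..<k} \<union> Row ` {..<n}) = k + n"
    by (subst card_Un_disjoint) (auto simp: card_image inj_on_def)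
  ultimately show ?thesis
    by (simp add: assignments_def crossings_free_diagram card_PiE)
qed

end

theory Submission
  imports Defs
begin

text \<open>
  Cancelling opposite neighbouring crossings and turning the row by a quarter turn, every
  assignment yields a double twist diagram that depends only on the net twists \<open>P\<close> of the column
  and \<open>Q\<close> of the row.  If \<open>P = 0\<close> or \<open>Q = 0\<close>, the other twist is undone by the first Reidemeister
  move.  Otherwise the determinant \<open>d = \<bar>1 + P Q\<bar>\<close> exceeds 1 because \<open>P\<close> and \<open>Q\<close> are even, and
  the diagram has at least \<open>d\<^sup>2\<close> dihedral colourings modulo \<open>d\<close>, while the circle has only \<open>d\<close>.
\<close>

section \<open>Equivalence of tangles\<close>

text \<open>Since \<open>move\<close> relates closed diagrams only, tangles with \<open>N\<close>
  strands above are compared inside every closure that supplies these strands. Equal numbers of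
  strands below make closedness of the two closures equivalent, hence symmetry and transitivity. A
  tangle that does not fit on \<open>N\<close> strands has no closure, and the second condition is
  vacuous for it.\<close>

definition tangle_equiv :: "nat \<Rightarrow> link_diagram \<Rightarrow> link_diagram \<Rightarrow> bool" where
  "tangle_equiv N D E \<longleftrightarrow> strands_below N D = strands_below N E \<and>
     (\<forall>U V. strands_below 0 U = Some N \<longrightarrow> closed_diagram (U @ D @ V) \<longrightarrow>
        diagram_equiv (U @ D @ V) (U @ E @ V))"

lemma tangle_equiv_refl: "tangle_equiv N D D"
  by (simp add: tangle_equiv_def)

lemma closed_diagram_context:
  assumes "strands_below 0 U = Some N" "strands_below N D = strands_below N E"
  shows "closed_diagram (U @ D @ V) \<longleftrightarrow> closed_diagram (U @ E @ V)"
  using assms by (simp add: closed_diagram_def strands_below_append)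

lemma tangle_equiv_sym:
  assumes "tangle_equiv N D E" shows "tangle_equiv N E D"
  using assms unfolding tangle_equiv_def
  by (metis closed_diagram_context equivclp_sym)

lemma tangle_equiv_trans [trans]:
  assumes "tangle_equiv N D E" "tangle_equiv N E F" shows "tangle_equiv N D F"
  using assms unfolding tangle_equiv_def
  by (metis closed_diagram_context equivclp_trans)

text \<open>Moves that erase pieces can fit on fewer strands on one side than on the other, so
  equality of the strand counts is a separate premise.\<close>

lemma tangle_equiv_local_move:
  assumes "local_move L R" "strands_below N L = strands_below N R"
  shows "tangle_equiv N L R"
  unfolding tangle_equiv_def
proof (intro conjI allI impI)
  fix U V
  assume "strands_below 0 U = Some N" "closed_diagram (U @ L @ V)"
  then have "move (U @ L @ V) (U @ R @ V)"
    using assms closed_diagram_context unfolding move_def by blast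
  then show "diagram_equiv (U @ L @ V) (U @ R @ V)"
    by (rule r_into_equivclp)
qed (rule assms)

text \<open>The surroundings \<open>U\<close> and \<open>V\<close> are absorbed into the closure.
  The equivalence is only required for the number of strands that \<open>U\<close> really
  leaves.\<close>

lemma tangle_equiv_context:
  assumes "\<And>M. strands_below N U = Some M \<Longrightarrow> tangle_equiv M D E"
  shows "tangle_equiv N (U @ D @ V) (U @ E @ V)"
proof (cases "strands_below N U")
  case None
  then show ?thesis
    by (simp add: tangle_equiv_def closed_diagram_def strands_below_append)
next
  case (Some M)
  have "tangle_equiv M D E"
    using assms Some .
  then have eq: "strands_below M D = strands_below M E"
    and equiv: "\<And>U V. \<lbrakk>strands_below 0 U = Some M; closed_diagram (U @ D @ V)\<rbrakk>
      \<Longrightarrow> diagram_equiv (U @ D @ V) (U @ E @ V)"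
    by (auto simp: tangle_equiv_def)
  have "diagram_equiv (U' @ (U @ D @ V) @ V') (U' @ (U @ E @ V) @ V')"
    if "strands_below 0 U' = Some N" "closed_diagram (U' @ (U @ D @ V) @ V')" for U' V'
    using equiv[of "U' @ U" "V @ V'"] that Some by (simp add: strands_below_append)
  with eq Some show ?thesis
    by (simp add: tangle_equiv_def strands_below_append)
qed

lemma tangle_equiv_Cons:
  assumes "\<And>M. strands_below N [x] = Some M \<Longrightarrow> tangle_equiv M D E"
  shows "tangle_equiv N (x # D) (x # E)"
  using tangle_equiv_context[of N "[x]" D E "[]"] assms by simp

lemma tangle_equiv_append:
  assumes "tangle_equiv N D E"
  shows "tangle_equiv N (D @ V) (E @ V)"
  using tangle_equiv_context[of N "[]" D E V] assms by simp

lemma diagram_equiv_if_tangle_equiv: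
  assumes "tangle_equiv 0 D E" "closed_diagram D"
  shows "diagram_equiv D E"
proof -
  have "closed_diagram ([] @ D @ []) \<Longrightarrow> diagram_equiv ([] @ D @ []) ([] @ E @ [])"
    using assms(1) unfolding tangle_equiv_def by (meson strands_below.simps(1))
  with assms(2) show ?thesis
    by simp
qed

lemma is_unknotI:
  assumes "tangle_equiv 0 D circle"
  shows "is_unknot D"
proof -
  have "closed_diagram circle"
    by (simp add: closed_diagram_def circle_def)
  then have "closed_diagram D"
    using assms by (simp add: tangle_equiv_def closed_diagram_def)
  then show ?thesis
    using assms by (simp add: is_unknot_def diagram_equiv_if_tangle_equiv)
qed

section \<open>Local moves as equivalences of tangles\<close>

lemma equiv_exchange:
  "tangle_equiv N [(i + ins p + m, q), (i, p)] [(i, p), (i + outs p + m, q)]"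
  by (rule tangle_equiv_local_move[OF exchange]) auto

text \<open>A whole tangle to the right of \<open>p\<close> slides past \<open>p\<close> one piece
  at a time. Its positions are counted from the first strand right of \<open>p\<close>, so sliding
  replaces the offset \<open>ins p\<close> by \<open>outs p\<close>.\<close>

lemma equiv_exchange_tangle:
  "tangle_equiv N (map (\<lambda>(j, q). (i + ins p + j, q)) D @ [(i, p)])
     ((i, p) # map (\<lambda>(j, q). (i + outs p + j, q)) D)"
proof (induction D arbitrary: N)
  case Nil
  show ?case
    by (simp add: tangle_equiv_refl)
next
  case (Cons x D)
  obtain j q where x: "x = (j, q)"
    by fastforce
  have "tangle_equiv N (map (\<lambda>(j, q). (i + ins p + j, q)) (x # D) @ [(i, p)])
      ((i + ins p + j, q) # (i, p) # map (\<lambda>(j, q). (i + outs p + j, q)) D)"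
    by (simp add: x) (rule tangle_equiv_Cons, rule Cons.IH)
  also have "tangle_equiv N \<dots> ((i, p) # map (\<lambda>(j, q). (i + outs p + j, q)) (x # D))"
    using tangle_equiv_append[OF equiv_exchange] by (simp add: x)
  finally show ?case .
qed

lemma equiv_zigzag_left: "i < N \<Longrightarrow> tangle_equiv N [(i, Cap), (i + 1, Cup)] []"
  by (rule tangle_equiv_local_move[OF zigzag_left]) auto

lemma equiv_zigzag_right: "i < N \<Longrightarrow> tangle_equiv N [(i + 1, Cap), (i, Cup)] []"
  by (rule tangle_equiv_local_move[OF zigzag_right]) auto

lemma equiv_rotate_cap:
  "tangle_equiv N [(i, Cap), (i + 1, Cross s)] [(i + 1, Cap), (i, Cross (other s))]"
  by (rule tangle_equiv_local_move[OF rotate_cap]) auto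

lemma other_other [simp]: "other (other s) = s"
  by (cases s) auto


section \<open>Twists\<close>

definition twist :: "nat \<Rightarrow> strand list \<Rightarrow> link_diagram" where
  "twist i w = map (\<lambda>s. (i, Cross s)) w"

lemma twist_simps [simp]: "twist i [] = []" "twist i (s # w) = (i, Cross s) # twist i w"
  by (simp_all add: twist_def)

text \<open>The handedness of a half twist in fixed position, not the sign of an oriented
  crossing.\<close>

fun twist_sign :: "strand \<Rightarrow> int" where
  "twist_sign Falling = 1" | "twist_sign Rising = -1"

definition net_twist :: "strand list \<Rightarrow> int" where
  "net_twist w = (\<Sum>s\<leftarrow>w. twist_sign s)"

lemma net_twist_simps [simp]:
  "net_twist [] = 0" "net_twist (s # w) = twist_sign s + net_twist w"
  by (simp_all add: net_twist_def)

lemma twist_sign_other [simp]: "twist_sign (other s) = - twist_sign s"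
  by (cases s) auto

lemma net_twist_other [simp]: "net_twist (map other w) = - net_twist w"
  by (induction w) auto

lemma net_twist_replicate: "net_twist (replicate m s) = int m * twist_sign s"
  by (induction m) (auto simp: algebra_simps)

lemma even_net_twist_iff: "even (net_twist w) \<longleftrightarrow> even (length w)"
proof (induction w)
  case (Cons s w)
  then show ?case by (cases s) auto
qed simp

lemma strands_below_twist [simp]: "i + 2 \<le> N \<Longrightarrow> strands_below N (twist i w) = Some N"
  unfolding twist_def by (rule strands_below_crosses)

text \<open>By induction the tail is already a run of equal crossings. A further crossing in front
  either prolongs the run or cancels against its first crossing by the second Reidemeister
  move.\<close>

lemma twist_normal_form:
  assumes "i + 2 \<le> N"
  shows "\<exists>m s. tangle_equiv N (twist i w) (twist i (replicate m s)) \<and>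
    net_twist w = net_twist (replicate m s)"
proof (induction w)
  case Nil
  have "tangle_equiv N (twist i []) (twist i (replicate 0 Falling))"
    by (simp add: tangle_equiv_refl)
  then show ?case
    by (metis replicate_0)
next
  case (Cons t w)
  then obtain m s where
    equiv: "tangle_equiv N (twist i w) (twist i (replicate m s))" and
    net: "net_twist w = net_twist (replicate m s)"
    by auto
  have step: "tangle_equiv N (twist i (t # w)) ((i, Cross t) # twist i (replicate m s))"
  proof -
    have "strands_below N [(i, Cross t)] = Some N"
      using assms by simp
    then show ?thesis
      using equiv by (auto simp del: strands_below.simps intro: tangle_equiv_Cons)
  qed
  \<comment> \<open>An empty run carries an arbitrary \<open>s\<close>, so it can be prolonged by
    any \<open>t\<close>.\<close>
  consider "m = 0 \<or> s = t" | l where "m = Suc l" "s = other t"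
    by (metis other.simps not0_implies_Suc strand.exhaust)
  then show ?case
  proof cases
    case 1
    then have "replicate (Suc m) t = t # replicate m s"
      by auto
    then have "tangle_equiv N (twist i (t # w)) (twist i (replicate (Suc m) t))"
      and "net_twist (t # w) = net_twist (replicate (Suc m) t)"
      using step net by auto
    then show ?thesis
      by blast
  next
    case 2
    have "tangle_equiv N ([(i, Cross t), (i, Cross (other t))] @ twist i (replicate l s))
        ([] @ twist i (replicate l s))"
      using assms by (intro tangle_equiv_append tangle_equiv_local_move[OF R2]) auto
    with step have "tangle_equiv N (twist i (t # w)) (twist i (replicate l s))"
      using 2 tangle_equiv_trans by auto
    moreover have "net_twist (t # w) = net_twist (replicate l s)"
      using net 2 by simp
    ultimately show ?thesis
      by blast
  qed
qed

lemma twist_cancel: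
  assumes "i + 2 \<le> N" "net_twist w = 0"
  shows "tangle_equiv N (twist i w) []"
proof -
  obtain m s where equiv: "tangle_equiv N (twist i w) (twist i (replicate m s))"
    and "net_twist w = net_twist (replicate m s)"
    using twist_normal_form[OF assms(1)] by blast
  then have "int m * twist_sign s = 0"
    using assms by (simp add: net_twist_replicate)
  then have "m = 0"
    by (cases s) auto
  with equiv show ?thesis
    by simp
qed

lemma cap_twist: "tangle_equiv N ((i, Cap) # twist i w) [(i, Cap)]"
proof (induction w)
  case Nil
  show ?case by (simp add: tangle_equiv_refl)
next
  case (Cons s w)
  have "tangle_equiv N ([(i, Cap), (i, Cross s)] @ twist i w) ([(i, Cap)] @ twist i w)"
    by (intro tangle_equiv_append tangle_equiv_local_move[OF R1_cap]) auto
  then show ?case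
    using Cons tangle_equiv_trans by auto
qed

lemma twist_cup: "tangle_equiv N (twist i w @ [(i, Cup)]) [(i, Cup)]"
proof (induction w rule: rev_induct)
  case Nil
  show ?case by (simp add: tangle_equiv_refl)
next
  case (snoc s w)
  have "tangle_equiv N (twist i w @ [(i, Cross s), (i, Cup)] @ []) (twist i w @ [(i, Cup)] @ [])"
    by (intro tangle_equiv_context tangle_equiv_local_move[OF R1_cup]) auto
  then show ?case
    using snoc tangle_equiv_trans by (auto simp: twist_def)
qed

section \<open>Rows and their quarter turn\<close>

fun row_crossings :: "nat \<Rightarrow> strand list \<Rightarrow> link_diagram" where
  "row_crossings i [] = []"
| "row_crossings i (s # w) = (i, Cross s) # row_crossings (i + 2) w"

text \<open>The row of \<open>free_diagram\<close> as a tangle on the strands \<open>i\<close>,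
  \<open>i + 1\<close>: every inner cap is inserted at the same place and pushes the earlier ones
  two strands to the right. For an empty list this degenerates to two vertical strands instead of
  two horizontal ones, so lemmas about rows ask for a nonempty list.\<close>

definition row :: "nat \<Rightarrow> strand list \<Rightarrow> link_diagram" where
  "row i w = replicate (length w - 1) (i + 1, Cap) @ row_crossings i w
     @ replicate (length w - 1) (i + 1, Cup)"

text \<open>A quarter turn makes a row into a column, and exchanges falling and rising strands.\<close>

definition turned_row :: "nat \<Rightarrow> strand list \<Rightarrow> link_diagram" where
  "turned_row i w = (i, Cap) # twist (i + 1) (map other w) @ [(i + 2, Cup)]"

text \<open>The crossing is rotated past the cap and lowered beneath the cup; cap and cup then form
  a zigzag.\<close>

lemma turned_row_single:
  assumes "i + 2 \<le> N"
  shows "tangle_equiv N (turned_row i [s]) [(i, Cross s)]"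
proof -
  have "tangle_equiv N (turned_row i [s]) [(i + 1, Cap), (i, Cross s), (i + 2, Cup)]"
    using tangle_equiv_append[OF equiv_rotate_cap[of N i "other s"], of "[(i + 2, Cup)]"]
    by (simp add: turned_row_def)
  also have "tangle_equiv N \<dots> [(i + 1, Cap), (i + 2, Cup), (i, Cross s)]"
    using equiv_exchange[of _ i "Cross s" 0 Cup] tangle_equiv_sym
    by (intro tangle_equiv_Cons) auto
  also have "tangle_equiv N \<dots> [(i, Cross s)]"
    using tangle_equiv_append[OF equiv_zigzag_left[of "i + 1" N], of "[(i, Cross s)]"] assms
    by simp
  finally show ?thesis .
qed

text \<open>Height exchanges isolate the first crossing together with the cap and the cup that
  connect it to the rest of the row.\<close>

lemma row_Cons:
  assumes "w \<noteq> []"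
  shows "tangle_equiv N (row i (s # w)) ([(i + 1, Cap), (i, Cross s)] @ row (i + 2) w @ [(i + 1, Cup)])"
proof -
  define m where "m = length w - 1"
  have len: "length w = Suc m"
    using assms by (cases w) (auto simp: m_def)
  let ?cups = "replicate (Suc m) (i + 1, Cup)"
  let ?cr = "row_crossings (i + 2) w"
  have "row i (s # w) = (replicate m (i + 1, Cap) @ [(i + 1, Cap)])
      @ (i, Cross s) # ?cr @ ?cups"
    by (simp add: row_def len replicate_append_same)
  \<comment> \<open>The last cap is the one next to the first crossing; raised to the top, it shifts
    the others two strands to the right.\<close>
  also have "tangle_equiv N \<dots> (((i + 1, Cap) # replicate m (i + 3, Cap))
      @ (i, Cross s) # ?cr @ ?cups)"
    using equiv_exchange_tangle[of N "i + 1" Cap "replicate m (0, Cap)"]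
    by (intro tangle_equiv_append) (simp add: eval_nat_numeral)
  also have "\<dots> = [(i + 1, Cap)] @ (replicate m (i + 3, Cap) @ [(i, Cross s)]) @ (?cr @ ?cups)"
    by simp
  also have "tangle_equiv N \<dots> ([(i + 1, Cap)] @ ((i, Cross s) # replicate m (i + 3, Cap))
      @ (?cr @ ?cups))"
    using equiv_exchange_tangle[of _ "i" "Cross s" "replicate m (1, Cap)"]
    by (intro tangle_equiv_context) (simp add: eval_nat_numeral)
  also have "\<dots> = ([(i + 1, Cap), (i, Cross s)] @ replicate m (i + 3, Cap) @ ?cr) @ ?cups @ []"
    by simp
  \<comment> \<open>The cups are treated in the mirrored way, by the same exchange read
    backwards.\<close>
  also have "tangle_equiv N \<dots> (([(i + 1, Cap), (i, Cross s)] @ replicate m (i + 3, Cap) @ ?cr)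
      @ (replicate m (i + 3, Cup) @ [(i + 1, Cup)]) @ [])"
    using equiv_exchange_tangle[of _ "i + 1" Cup "replicate m (0, Cup)"] tangle_equiv_sym
    by (intro tangle_equiv_context) (simp add: eval_nat_numeral)
  also have "\<dots> = [(i + 1, Cap), (i, Cross s)] @ row (i + 2) w @ [(i + 1, Cup)]"
    by (simp add: row_def len eval_nat_numeral)
  finally show ?thesis .
qed

text \<open>By induction the rest of the row is turned first. The first crossing is then rotated
  past its cap, and a zigzag is straightened so that it continues the column of the rest.\<close>

lemma row_equiv_turned_row:
  assumes "w \<noteq> []" "i + 2 \<le> N"
  shows "tangle_equiv N (row i w) (turned_row i w)"
  using assms
proof (induction w arbitrary: i N rule: list_nonempty_induct)
  case (single s)
  then show ?case
    using tangle_equiv_sym[OF turned_row_single] by (simp add: row_def)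
next
  case (cons s w)
  let ?v = "map other w"
  have "tangle_equiv N (row i (s # w))
      ([(i + 1, Cap), (i, Cross s)] @ row (i + 2) w @ [(i + 1, Cup)])"
    using cons.hyps by (rule row_Cons)
  also have "tangle_equiv N \<dots> ([(i + 1, Cap), (i, Cross s)] @ turned_row (i + 2) w @ [(i + 1, Cup)])"
    using cons.prems by (intro tangle_equiv_context cons.IH) (auto split: if_splits)
  also have "tangle_equiv N \<dots>
      ([(i, Cap), (i + 1, Cross (other s))] @ turned_row (i + 2) w @ [(i + 1, Cup)])"
    using tangle_equiv_sym[OF equiv_rotate_cap[of N i "other s"]]
    by (intro tangle_equiv_append) simp
  also have "\<dots> = [(i, Cap), (i + 1, Cross (other s)), (i + 2, Cap)] @
      (twist (i + 3) ?v @ [(i + 4, Cup)] @ [(i + 1, Cup)]) @ []"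
    by (simp add: turned_row_def eval_nat_numeral)
  \<comment> \<open>The connecting cup rises on the left of the turned rest until it meets the cap
    of that rest.\<close>
  also have "tangle_equiv N \<dots> ([(i, Cap), (i + 1, Cross (other s)), (i + 2, Cap)] @
      ((i + 1, Cup) # twist (i + 1) ?v @ [(i + 2, Cup)]) @ [])"
    using equiv_exchange_tangle[of _ "i + 1" Cup "twist 0 ?v @ [(1, Cup)]"]
    by (intro tangle_equiv_context) (simp add: twist_def comp_def eval_nat_numeral)
  also have "\<dots> = [(i, Cap), (i + 1, Cross (other s))] @ [(i + 1 + 1, Cap), (i + 1, Cup)] @
      (twist (i + 1) ?v @ [(i + 2, Cup)])"
    by simp
  also have "tangle_equiv N \<dots> ([(i, Cap), (i + 1, Cross (other s))] @ [] @
      (twist (i + 1) ?v @ [(i + 2, Cup)]))"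
    using cons.prems by (intro tangle_equiv_context equiv_zigzag_right) (auto split: if_splits)
  also have "\<dots> = turned_row i (s # w)"
    by (simp add: turned_row_def)
  finally show ?case .
qed


section \<open>Double twist diagrams\<close>

text \<open>The usual two-bridge picture of a double twist knot or link. The list \<open>w\<close>
  keeps the labels of the row; \<open>turned_row\<close> exchanges them.\<close>

definition double_twist :: "strand list \<Rightarrow> strand list \<Rightarrow> link_diagram" where
  "double_twist v w = [(0, Cap), (2, Cap)] @ twist 1 v @ turned_row 1 w @ [(0, Cup), (0, Cup)]"

lemma double_twist_equiv_row:
  assumes "w \<noteq> []"
  shows "tangle_equiv 0 ([(0, Cap), (2, Cap)] @ twist 1 v @ row 1 w @ [(0, Cup), (0, Cup)])
    (double_twist v w)"
proof -
  have "tangle_equiv 0 (([(0, Cap), (2, Cap)] @ twist 1 v) @ row 1 w @ [(0, Cup), (0, Cup)])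
      (([(0, Cap), (2, Cap)] @ twist 1 v) @ turned_row 1 w @ [(0, Cup), (0, Cup)])"
    using assms by (intro tangle_equiv_context row_equiv_turned_row) auto
  then show ?thesis
    by (simp add: double_twist_def)
qed

text \<open>Without row twists, the cup of the turned row can be raised to close the column from
  below, where the first Reidemeister move removes all its crossings.\<close>

lemma double_twist_unknot_row:
  assumes "net_twist w = 0"
  shows "tangle_equiv 0 (double_twist v w) circle"
proof -
  have "double_twist v w = ([(0, Cap), (2, Cap)] @ twist 1 v @ [(1, Cap)]) @ twist 2 (map other w)
      @ [(3, Cup), (0, Cup), (0, Cup)]"
    by (simp add: double_twist_def turned_row_def eval_nat_numeral)
  also have "tangle_equiv 0 \<dots> (([(0, Cap), (2, Cap)] @ twist 1 v @ [(1, Cap)]) @ []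
      @ [(3, Cup), (0, Cup), (0, Cup)])"
    using assms by (intro tangle_equiv_context twist_cancel) (auto simp: strands_below_append)
  also have "\<dots> = ([(0, Cap), (2, Cap)] @ twist 1 v) @ [(1, Cap), (3, Cup)] @ [(0, Cup), (0, Cup)]"
    by simp
  also have "tangle_equiv 0 \<dots> (([(0, Cap), (2, Cap)] @ twist 1 v) @ [(1, Cup), (1, Cap)]
      @ [(0, Cup), (0, Cup)])"
    using equiv_exchange[of _ 1 Cap 0 Cup] tangle_equiv_sym
    by (intro tangle_equiv_context) (simp add: eval_nat_numeral)
  also have "\<dots> = [(0, Cap), (2, Cap)] @ (twist 1 v @ [(1, Cup)]) @ [(1, Cap), (0, Cup), (0, Cup)]"
    by simp
  also have "tangle_equiv 0 \<dots> ([(0, Cap), (2, Cap)] @ [(1, Cup)] @ [(1, Cap), (0, Cup), (0, Cup)])"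
    by (intro tangle_equiv_context twist_cup)
  also have "\<dots> = [(0, Cap)] @ [(1 + 1, Cap), (1, Cup)] @ [(1, Cap), (0, Cup), (0, Cup)]"
    by simp
  also have "tangle_equiv 0 \<dots> ([(0, Cap)] @ [] @ [(1, Cap), (0, Cup), (0, Cup)])"
    by (intro tangle_equiv_context equiv_zigzag_right) auto
  also have "\<dots> = [(0, Cap)] @ [(0 + 1, Cap), (0, Cup)] @ [(0, Cup)]"
    by simp
  also have "tangle_equiv 0 \<dots> ([(0, Cap)] @ [] @ [(0, Cup)])"
    by (intro tangle_equiv_context equiv_zigzag_right) auto
  also have "\<dots> = circle"
    by (simp add: circle_def)
  finally show ?thesis .
qed

text \<open>Without column twists, the cup of the left arc can be raised and straightened. The
  turned row then hangs directly below a cap, which absorbs its crossings by the first Reidemeister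
  move.\<close>

lemma double_twist_unknot_column:
  assumes "net_twist v = 0"
  shows "tangle_equiv 0 (double_twist v w) circle"
proof -
  let ?w = "map other w"
  have "tangle_equiv 0 (double_twist v w)
      ([(0, Cap), (2, Cap)] @ [] @ turned_row 1 w @ [(0, Cup), (0, Cup)])"
    unfolding double_twist_def using assms by (intro tangle_equiv_context twist_cancel) auto
  also have "\<dots> = [(0, Cap), (2, Cap), (1, Cap)] @ (twist 2 ?w @ [(3, Cup)] @ [(0, Cup)]) @ [(0, Cup)]"
    by (simp add: turned_row_def eval_nat_numeral)
  also have "tangle_equiv 0 \<dots> ([(0, Cap), (2, Cap), (1, Cap)]
      @ ((0, Cup) # twist 0 ?w @ [(1, Cup)]) @ [(0, Cup)])"
    using equiv_exchange_tangle[of _ 0 Cup "twist 0 ?w @ [(1, Cup)]"]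
    by (intro tangle_equiv_context) (simp add: twist_def comp_def eval_nat_numeral)
  also have "\<dots> = [(0, Cap), (2, Cap)] @ [(0 + 1, Cap), (0, Cup)] @ (twist 0 ?w @ [(1, Cup), (0, Cup)])"
    by simp
  also have "tangle_equiv 0 \<dots> ([(0, Cap), (2, Cap)] @ [] @ (twist 0 ?w @ [(1, Cup), (0, Cup)]))"
    by (intro tangle_equiv_context equiv_zigzag_right) auto
  also have "\<dots> = [(0, Cap), (2, Cap)] @ (twist 0 ?w @ [(1, Cup), (0, Cup)])"
    by simp
  also have "tangle_equiv 0 \<dots> ([(0, Cap), (0, Cap)] @ (twist 0 ?w @ [(1, Cup), (0, Cup)]))"
    using equiv_exchange[of _ 0 Cap 0 Cap] tangle_equiv_sym
    by (intro tangle_equiv_append) (simp add: eval_nat_numeral)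
  also have "\<dots> = [(0, Cap)] @ ((0, Cap) # twist 0 ?w) @ [(1, Cup), (0, Cup)]"
    by simp
  also have "tangle_equiv 0 \<dots> ([(0, Cap)] @ [(0, Cap)] @ [(1, Cup), (0, Cup)])"
    by (intro tangle_equiv_context cap_twist)
  also have "\<dots> = [(0, Cap)] @ [(0, Cap), (0 + 1, Cup)] @ [(0, Cup)]"
    by simp
  also have "tangle_equiv 0 \<dots> ([(0, Cap)] @ [] @ [(0, Cup)])"
    by (intro tangle_equiv_context equiv_zigzag_left) auto
  also have "\<dots> = circle"
    by (simp add: circle_def)
  finally show ?thesis .
qed


section \<open>Colourings by involutory quandles\<close>

text \<open>The axioms \<open>reflect_self\<close>, \<open>reflect_reflect\<close> and
  \<open>reflect_distrib\<close> mirror the three Reidemeister moves. Reflections are involutions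
  because the diagrams are unoriented; finiteness allows counting.\<close>

locale finite_involutory_quandle =
  fixes C :: "'a set" and reflect :: "'a \<Rightarrow> 'a \<Rightarrow> 'a"
  assumes finite_C: "finite C"
    and reflect_closed: "\<lbrakk>x \<in> C; y \<in> C\<rbrakk> \<Longrightarrow> reflect x y \<in> C"
    and reflect_self: "x \<in> C \<Longrightarrow> reflect x x = x"
    and reflect_reflect: "\<lbrakk>x \<in> C; y \<in> C\<rbrakk> \<Longrightarrow> reflect x (reflect x y) = y"
    and reflect_distrib: "\<lbrakk>x \<in> C; y \<in> C; z \<in> C\<rbrakk> \<Longrightarrow>
      reflect x (reflect y z) = reflect (reflect x y) (reflect x z)"
begin

text \<open>The colours of the upper ends determine those of the lower ends, listed from left to
  right: the overstrand keeps its colour and reflects that of the other strand.\<close>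

fun cross :: "strand \<Rightarrow> 'a \<Rightarrow> 'a \<Rightarrow> 'a list" where
  "cross Falling x y = [reflect x y, x]"
| "cross Rising x y = [y, reflect y x]"

text \<open>The number of ways to colour the strands of a diagram below its top, whose strands have
  the colours \<open>X\<close>.\<close>

fun colourings :: "link_diagram \<Rightarrow> 'a list \<Rightarrow> nat" where
  "colourings [] X = 1"
| "colourings ((i, Cap) # D) X = (\<Sum>x\<in>C. colourings D (take i X @ [x, x] @ drop i X))"
| "colourings ((i, Cup) # D) X =
     (if X ! i = X ! (i + 1) then colourings D (take i X @ drop (i + 2) X) else 0)"
| "colourings ((i, Cross s) # D) X =
     colourings D (take i X @ cross s (X ! i) (X ! (i + 1)) @ drop (i + 2) X)"

lemma set_cross: "\<lbrakk>x \<in> C; y \<in> C\<rbrakk> \<Longrightarrow> set (cross s x y) \<subseteq> C"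
  by (cases s) (auto intro: reflect_closed)

lemma length_cross [simp]: "length (cross s x y) = 2"
  by (cases s) auto

lemma split_at:
  assumes "i \<le> length X" "set X \<subseteq> C"
  obtains A B where "X = A @ B" "length A = i" "set A \<subseteq> C" "set B \<subseteq> C"
  using assms that[of "take i X" "drop i X"] by (auto dest: in_set_takeD in_set_dropD)

lemma split_around1:
  assumes "i + 1 \<le> length X" "set X \<subseteq> C"
  obtains A x B where "X = A @ x # B" "length A = i" "x \<in> C"
proof -
  obtain A Y where "X = A @ Y" "length A = i" "set Y \<subseteq> C"
    using assms split_at[of i X] by (metis add_leD1)
  with assms that show thesis
    by (cases Y) auto
qed

lemma split_around2:
  assumes "i + 2 \<le> length X" "set X \<subseteq> C"
  obtains A x y B where "X = A @ x # y # B" "length A = i" "x \<in> C" "y \<in> C"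
proof -
  obtain A x Y where "X = A @ x # Y" "length A = i" "x \<in> C"
    using assms split_around1[of i X] by (metis add_leD1 one_add_one group_cancel.add1)
  with assms that show thesis
    by (cases Y) auto
qed

lemma split_around3:
  assumes "i + 3 \<le> length X" "set X \<subseteq> C"
  obtains A x y z B where "X = A @ x # y # z # B" "length A = i" "x \<in> C" "y \<in> C" "z \<in> C"
proof -
  have "i + 2 \<le> length X"
    using assms by simp
  then obtain A x y Y where "X = A @ x # y # Y" "length A = i" "x \<in> C" "y \<in> C"
    using assms split_around2[of i X] by metis
  with assms that show thesis
    by (cases Y) auto
qed

text \<open>The local effect of one piece, for the number \<open>F\<close> of colourings below it.\<close>

fun act :: "strand piece \<Rightarrow> ('a list \<Rightarrow> nat) \<Rightarrow> 'a list \<Rightarrow> nat" where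
  "act Cap F P = (\<Sum>x\<in>C. F [x, x])"
| "act Cup F P = (if P ! 0 = P ! 1 then F [] else 0)"
| "act (Cross s) F P = F (cross s (P ! 0) (P ! 1))"

section \<open>Invariance of the number of colourings\<close>

lemma colourings_Cons:
  assumes "length A = i" "length P = ins p"
  shows "colourings ((i, p) # D) (A @ P @ B) = act p (\<lambda>Y. colourings D (A @ Y @ B)) P"
  using assms by (cases p) (auto simp: nth_append)

lemma act_cong:
  assumes "\<And>Y. length Y = outs p \<Longrightarrow> F Y = G Y"
  shows "act p F P = act p G P"
  using assms by (cases p) auto

lemma act_commute: "act p (\<lambda>Y. act q (F Y) Q) P = act q (\<lambda>Z. act p (\<lambda>Y. F Y Z) P) Q"
  by (cases p; cases q) (auto intro: sum.swap)

text \<open>The inputs \<open>P\<close> of \<open>p\<close> and \<open>Q\<close> of \<open>q\<close>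
  are disjoint blocks of strands, so both orders are nested applications of \<open>act\<close>,
  which commute.\<close>

lemma colourings_exchange:
  assumes "length A = i" "length P = ins p" "length M = m" "length Q = ins q"
  shows "colourings ((i + ins p + m, q) # (i, p) # D) (A @ P @ M @ Q @ B)
    = colourings ((i, p) # (i + outs p + m, q) # D) (A @ P @ M @ Q @ B)"
proof -
  have "colourings ((i + ins p + m, q) # (i, p) # D) (A @ P @ M @ Q @ B)
      = act q (\<lambda>Z. colourings ((i, p) # D) (A @ P @ M @ Z @ B)) Q"
    using colourings_Cons[of "A @ P @ M" _ Q] assms by simp
  also have "\<dots> = act q (\<lambda>Z. act p (\<lambda>Y. colourings D (A @ Y @ M @ Z @ B)) P) Q"
    using colourings_Cons[of A i P p] assms by simp
  also have "\<dots> = act p (\<lambda>Y. act q (\<lambda>Z. colourings D (A @ Y @ M @ Z @ B)) Q) P"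
    by (rule act_commute)
  also have "\<dots> = act p (\<lambda>Y. colourings ((i + outs p + m, q) # D) (A @ Y @ M @ Q @ B)) P"
    using colourings_Cons[of "A @ Y @ M" "i + outs p + m" Q q D B for Y] assms
    by (intro act_cong) simp
  also have "\<dots> = colourings ((i, p) # (i + outs p + m, q) # D) (A @ P @ M @ Q @ B)"
    using colourings_Cons[of A i P p] assms by simp
  finally show ?thesis .
qed

text \<open>Reindexing along the involution \<open>reflect b\<close>. This is what rotating past a
  cap requires when the through strand, coloured \<open>b\<close>, is the overstrand: the colours of
  the cap are then counted from its other leg.\<close>

lemma sum_reflect:
  fixes f :: "'a \<Rightarrow> 'a \<Rightarrow> nat"
  assumes "b \<in> C"
  shows "(\<Sum>x\<in>C. f x (reflect b x)) = (\<Sum>x\<in>C. f (reflect b x) x)"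
  by (rule sum.reindex_bij_witness[of _ "reflect b" "reflect b"])
    (use assms in \<open>auto simp: reflect_closed reflect_reflect\<close>)

text \<open>Distributivity as conjugation of reflections, oriented as a rewrite rule for the third
  Reidemeister move.\<close>

lemma reflect_conj:
  assumes "x \<in> C" "y \<in> C" "z \<in> C"
  shows "reflect (reflect x y) z = reflect x (reflect y (reflect x z))"
  using reflect_distrib[of x y "reflect x z"] assms by (simp add: reflect_closed reflect_reflect)

lemma reflect_eq_iff:
  assumes "x \<in> C" "y \<in> C" "z \<in> C"
  shows "reflect x y = z \<longleftrightarrow> y = reflect x z"
  using assms reflect_reflect by metis

lemma colourings_local_move:
  assumes "local_move L R" "length X = N" "set X \<subseteq> C"
    and "strands_below N L \<noteq> None" "strands_below N R \<noteq> None"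
  shows "colourings (L @ D) X = colourings (R @ D) X"
  using assms
proof (induction L R rule: local_move.induct)
  case (exchange i p m q)
  then have "i + (ins p + (m + ins q)) \<le> length X"
    by (auto split: if_splits)
  then obtain A X1 where X: "X = A @ X1" "length A = i" "set X1 \<subseteq> C"
    using exchange.prems split_at[of i X] by (metis add_leD1)
  then have "ins p + (m + ins q) \<le> length X1"
    using \<open>_ \<le> length X\<close> by simp
  then obtain P X2 where X1: "X1 = P @ X2" "length P = ins p" "set X2 \<subseteq> C"
    using X split_at[of "ins p" X1] by (metis add_leD1)
  then have "m + ins q \<le> length X2"
    using \<open>_ \<le> length X1\<close> by simp
  then obtain M X3 where X2: "X2 = M @ X3" "length M = m" "set X3 \<subseteq> C"
    using X1 split_at[of m X2] by (metis add_leD1)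
  then have "ins q \<le> length X3"
    using \<open>_ \<le> length X2\<close> by simp
  then obtain Q B where "X3 = Q @ B" "length Q = ins q"
    using X2 split_at[of "ins q" X3] by metis
  then show ?case
    using colourings_exchange X X1 X2 by simp
next
  case (zigzag_left i)
  then obtain A b B where "X = A @ b # B" "length A = i" "b \<in> C"
    using split_around1[of i X] by (auto split: if_splits)
  then show ?case
    by (simp add: nth_append finite_C)
next
  case (zigzag_right i)
  then obtain A b B where "X = A @ b # B" "length A = i" "b \<in> C"
    using split_around1[of i X] by (auto split: if_splits)
  then show ?case
    by (simp add: nth_append finite_C)
next
  case (rotate_cap i s)
  then obtain A b B where "X = A @ b # B" "length A = i" "b \<in> C"
    using split_around1[of i X] by (auto split: if_splits)
  then show ?case
    using sum_reflect[of b "\<lambda>x y. colourings D (A @ x # b # y # B)"]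
    by (cases s) (simp_all add: nth_append)
next
  case (rotate_cup i s)
  then obtain A x y z B where "X = A @ x # y # z # B" "length A = i" "x \<in> C" "y \<in> C" "z \<in> C"
    using split_around3[of i X] by (auto split: if_splits)
  then show ?case
    by (cases s) (auto simp: nth_append reflect_eq_iff reflect_reflect)
next
  case (R1_cap i s)
  then obtain A B where "X = A @ B" "length A = i"
    using split_at[of i X] by (auto split: if_splits)
  then show ?case
    by (cases s) (simp_all add: nth_append reflect_self)
next
  case (R1_cup i s)
  then obtain A x y B where "X = A @ x # y # B" "length A = i" "x \<in> C" "y \<in> C"
    using split_around2[of i X] by (auto split: if_splits)
  \<comment> \<open>The cup tests equality below the crossing; this is the same as equality above
    it.\<close>
  moreover from this have "reflect x y = x \<longleftrightarrow> x = y" "y = reflect y x \<longleftrightarrow> x = y"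
    by (metis reflect_reflect reflect_self)+
  ultimately show ?case
    by (cases s) (auto simp: nth_append)
next
  case (R2 i s)
  then obtain A x y B where "X = A @ x # y # B" "length A = i" "x \<in> C" "y \<in> C"
    using split_around2[of i X] by (auto split: if_splits)
  then show ?case
    by (cases s) (simp_all add: nth_append reflect_reflect)
next
  case (R3 s r t i)
  then obtain A x y z B where "X = A @ x # y # z # B" "length A = i" "x \<in> C" "y \<in> C" "z \<in> C"
    using split_around3[of i X] by (auto split: if_splits)
  with R3 show ?case
    \<comment> \<open>The premise of the move discards the two cyclic patterns among the
      eight.\<close>
    by (cases r; cases s; cases t)
      (simp_all add: nth_append reflect_conj reflect_closed reflect_reflect)
qed

text \<open>Pieces above only produce admissible colour lists of the right length, so agreement
  below them carries upwards.\<close>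

lemma colourings_context:
  assumes "strands_below N U = Some M" "length X = N" "set X \<subseteq> C"
    and "\<And>Y. \<lbrakk>length Y = M; set Y \<subseteq> C\<rbrakk> \<Longrightarrow> colourings D Y = colourings E Y"
  shows "colourings (U @ D) X = colourings (U @ E) X"
  using assms(1-3)
proof (induction N U arbitrary: X rule: strands_below.induct)
  case (1 N)
  then show ?case
    using assms(4) by simp
next
  case (2 N i p U)
  then have le: "i + ins p \<le> length X"
    by (auto split: if_splits)
  show ?case
  proof (cases p)
    case Cap
    have "colourings (U @ D) (take i X @ [x, x] @ drop i X)
        = colourings (U @ E) (take i X @ [x, x] @ drop i X)" if "x \<in> C" for x
      using 2 le that Cap by (intro "2.IH") (auto dest: in_set_takeD in_set_dropD)
    then show ?thesis
      using Cap by simp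
  next
    case Cup
    have "colourings (U @ D) (take i X @ drop (i + 2) X)
        = colourings (U @ E) (take i X @ drop (i + 2) X)"
      using 2 le Cup by (intro "2.IH") (auto dest: in_set_takeD in_set_dropD)
    then show ?thesis
      using Cup by simp
  next
    case (Cross s)
    let ?Y = "take i X @ cross s (X ! i) (X ! (i + 1)) @ drop (i + 2) X"
    have "X ! i \<in> C" "X ! (i + 1) \<in> C"
      using 2 le Cross by (auto simp: subset_iff)
    then have "set (cross s (X ! i) (X ! (i + 1))) \<subseteq> C"
      by (rule set_cross)
    then have "set ?Y \<subseteq> C"
      using 2 by (auto dest: in_set_takeD in_set_dropD)
    moreover have "length ?Y = N - ins p + outs p"
      using 2 le Cross by simp
    ultimately have "colourings (U @ D) ?Y = colourings (U @ E) ?Y"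
      using 2 le by (intro "2.IH") auto
    then show ?thesis
      using Cross by simp
  qed
qed

lemma colourings_move:
  assumes "move D E"
  shows "colourings D [] = colourings E []"
proof -
  obtain U L R V where "local_move L R" and D: "D = U @ L @ V" and E: "E = U @ R @ V"
    and closed: "closed_diagram D" "closed_diagram E"
    using assms unfolding move_def by blast
  obtain M where M: "strands_below 0 U = Some M"
    using closed(1) by (auto simp: D closed_diagram_def strands_below_append split: option.splits)
  have "strands_below M L \<noteq> None" "strands_below M R \<noteq> None"
    using closed M by (auto simp: D E closed_diagram_def strands_below_append split: option.splits)
  then show ?thesis
    unfolding D E using M colourings_local_move[OF \<open>local_move L R\<close>]
    by (intro colourings_context[OF M]) auto
qed

lemma colourings_diagram_equiv:
  assumes "diagram_equiv D E"
  shows "colourings D [] = colourings E []"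
  using assms by (induction rule: equivclp_induct) (auto dest: colourings_move)

lemma colourings_circle: "colourings circle [] = card C"
  by (simp add: circle_def)

end


section \<open>Dihedral colourings of double twist diagrams\<close>

text \<open>Reflections of the regular \<open>d\<close>-gon: the colourings are the Fox colourings
  modulo \<open>d\<close>.\<close>

locale dihedral =
  fixes d :: int
  assumes d_pos: "d > 0"
begin

lemma reflection_mod: "(2 * (x mod d) - y mod d) mod d = (2 * x - y) mod d"
  by (intro mod_diff_cong mod_mult_cong) auto

sublocale finite_involutory_quandle "{0..<d}" "\<lambda>x y. (2 * x - y) mod d"
proof
  fix x y z
  show "(2 * x - (2 * y - z) mod d) mod d
      = (2 * ((2 * x - y) mod d) - (2 * x - z) mod d) mod d"
    by (subst reflection_mod, subst mod_diff_right_eq) (simp add: algebra_simps)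
qed (use d_pos in \<open>auto simp: mod_diff_right_eq\<close>)

text \<open>Each crossing shifts both colours by \<delta> or -\<delta> according to its sign and
  preserves their difference, so only the net twist matters.\<close>

lemma colourings_twist:
  assumes "length A = i"
  shows "colourings (twist i w @ D) (A @ u mod d # (u - \<delta>) mod d # B)
    = colourings D (A @ (u + net_twist w * \<delta>) mod d # (u + net_twist w * \<delta> - \<delta>) mod d # B)"
proof (induction w arbitrary: u)
  case (Cons s w)
  have "cross s (u mod d) ((u - \<delta>) mod d)
      = [(u + twist_sign s * \<delta>) mod d, (u + twist_sign s * \<delta> - \<delta>) mod d]"
  proof -
    have "2 * u - (u - \<delta>) = u + \<delta>" "2 * (u - \<delta>) - u = u - \<delta> - \<delta>"
      by simp_all
    then show ?thesis
      by (cases s) (simp_all only: cross.simps reflection_mod twist_sign.simps, simp_all)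
  qed
  then have "colourings (twist i (s # w) @ D) (A @ u mod d # (u - \<delta>) mod d # B)
      = colourings (twist i w @ D)
          (A @ (u + twist_sign s * \<delta>) mod d # (u + twist_sign s * \<delta> - \<delta>) mod d # B)"
    using assms by (simp add: nth_append)
  moreover have "u + net_twist (s # w) * \<delta> = u + twist_sign s * \<delta> + net_twist w * \<delta>"
    by (simp add: distrib_right)
  ultimately show ?case
    by (simp only: Cons)
qed simp

lemma colourings_cap_ge:
  assumes "x \<in> {0..<d}"
  shows "colourings D (take i X @ [x, x] @ drop i X) \<le> colourings ((i, Cap) # D) X"
  using assms member_le_sum[of x "{0..<d}" "\<lambda>x. colourings D (take i X @ [x, x] @ drop i X)"]
  by simp

text \<open>Any colours \<open>x\<close>, \<open>y\<close> of the two top caps extend downwards: the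
  column shifts by \<open>P * \<delta>\<close>, the turned row by \<open>P * Q * \<delta>\<close>,
  and the ends match because \<open>d\<close> divides \<open>(1 + P * Q) * \<delta>\<close>.\<close>

lemma colourings_double_twist_below_caps:
  assumes "d dvd 1 + net_twist v * net_twist w" "x \<in> {0..<d}" "y \<in> {0..<d}"
  shows "1 \<le> colourings (twist 1 v @ turned_row 1 w @ [(0, Cup), (0, Cup)]) [x, x, y, y]"
proof -
  define P Q \<delta> where "P = net_twist v" and "Q = net_twist w" and "\<delta> = x - y"
  have xy: "x = x mod d" "y = (x - \<delta>) mod d"
    using assms by (auto simp: \<delta>_def)
  have "d dvd (1 + P * Q) * \<delta>"
    using assms(1) by (simp add: P_def Q_def)
  \<comment> \<open>These are the matching conditions at the last cup and at the cup of the turned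
    row; both express one congruence.\<close>
  then have closes: "(x + P * Q * \<delta>) mod d = (x - \<delta>) mod d"
    "(x + P * \<delta> + P * Q * \<delta>) mod d = (x + P * \<delta> - \<delta>) mod d"
    by (simp_all add: mod_eq_dvd_iff algebra_simps)
  let ?V = "[(0, Cup), (0, Cup)]"
  let ?D = "twist 2 (map other w) @ [(3, Cup), (0, Cup), (0, Cup)]"
  let ?c = "(x + P * \<delta>) mod d" and ?e = "(x + P * \<delta> - \<delta>) mod d"
  have "colourings (twist 1 v @ turned_row 1 w @ ?V) [x, x, y, y]
      = colourings (turned_row 1 w @ ?V) [x, ?c, ?e, y]"
    using colourings_twist[of "[x]" 1 v "turned_row 1 w @ ?V" x \<delta> "[y]"] xy
    by (simp add: P_def)
  also have "\<dots> = colourings ((1, Cap) # ?D) [x, ?c, ?e, y]"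
    by (simp add: turned_row_def eval_nat_numeral)
  \<comment> \<open>The cap of the turned row gets the colour \<open>x\<close> because its left leg
    is later joined to the left arc.\<close>
  also have "\<dots> \<ge> colourings ?D [x, x, x, ?c, ?e, y]"
    using colourings_cap_ge[of x ?D 1 "[x, ?c, ?e, y]"] assms by simp
  \<comment> \<open>The pair \<open>x\<close>, \<open>?c\<close> has difference
    \<open>- P * \<delta>\<close>, and \<open>map other w\<close> has net twist \<open>- Q\<close>;
    the two signs cancel in the shift.\<close>
  also have "colourings ?D [x, x, x, ?c, ?e, y] = colourings [(3, Cup), (0, Cup), (0, Cup)]
      [x, x, (x + P * Q * \<delta>) mod d, (x + P * \<delta> + P * Q * \<delta>) mod d, ?e, y]"
    using colourings_twist[of "[x, x]" 2 "map other w" "[(3, Cup), (0, Cup), (0, Cup)]" x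
        "- P * \<delta>" "[?e, y]"] xy
    by (simp add: Q_def algebra_simps)
  also have "\<dots> = 1"
    using closes xy by simp
  finally show ?thesis .
qed

lemma colourings_double_twist:
  assumes "d dvd 1 + net_twist v * net_twist w"
  shows "nat d * nat d \<le> colourings (double_twist v w) []"
proof -
  let ?D = "twist 1 v @ turned_row 1 w @ [(0, Cup), (0, Cup)]"
  have "nat d * nat d = (\<Sum>x\<in>{0..<d}. \<Sum>y\<in>{0..<d}. 1)"
    by simp
  also have "\<dots> \<le> (\<Sum>x\<in>{0..<d}. \<Sum>y\<in>{0..<d}. colourings ?D [x, x, y, y])"
    using colourings_double_twist_below_caps[OF assms] by (intro sum_mono) blast
  also have "\<dots> = colourings (double_twist v w) []"
    by (simp add: double_twist_def eval_nat_numeral)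
  finally show ?thesis .
qed

end

text \<open>With \<open>d\<close> the absolute value of \<open>1 + P * Q\<close>, invariance would
  force at least \<open>d * d\<close> colourings to equal the \<open>d\<close> colourings of the
  circle, impossible for \<open>d \<ge> 2\<close>.\<close>

lemma double_twist_knotted:
  assumes "even (length v)" "even (length w)" "net_twist v \<noteq> 0" "net_twist w \<noteq> 0"
  shows "\<not> diagram_equiv (double_twist v w) circle"
proof
  assume equiv: "diagram_equiv (double_twist v w) circle"
  let ?z = "net_twist v * net_twist w"
  define d where "d = \<bar>1 + ?z\<bar>"
  have "even ?z" "?z \<noteq> 0"
    using assms by (auto simp: even_net_twist_iff)
  \<comment> \<open>Besides 0, only this value of the product gives \<open>d = 1\<close>; it is
    excluded because 4 divides a product of even numbers.\<close>
  moreover have "?z \<noteq> -2"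
  proof
    assume "?z = -2"
    moreover have "2 * 2 dvd ?z"
      using assms by (intro mult_dvd_mono) (auto simp: even_net_twist_iff)
    ultimately show False
      by simp
  qed
  moreover have "\<bar>1 + z\<bar> \<ge> 2" if "even z" "z \<noteq> 0" "z \<noteq> -2" for z :: int
    using that by presburger
  ultimately have "d \<ge> 2"
    unfolding d_def by blast
  then interpret dihedral d
    by unfold_locales simp
  have "nat d * nat d \<le> colourings (double_twist v w) []"
    by (rule colourings_double_twist) (simp add: d_def)
  also have "\<dots> = nat d"
    using colourings_diagram_equiv[OF equiv] colourings_circle by simp
  finally show False
    using \<open>d \<ge> 2\<close> by simp
qed


section \<open>Counting the unknotted assignments\<close>

lemma row_crossings_upt:
  "row_crossings (2 * m + 1) (map f [m..<n]) = map (\<lambda>j. (2 * j + 1, Cross (f j))) [m..<n]"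
proof (induction "n - m" arbitrary: m)
  case (Suc l)
  have upt: "[m..<n] = m # [Suc m..<n]"
    using Suc.hyps(2) by (intro upt_conv_Cons) simp
  moreover have "2 * m + 1 + 2 = 2 * Suc m + 1"
    by simp
  moreover have "row_crossings (2 * Suc m + 1) (map f [Suc m..<n])
      = map (\<lambda>j. (2 * j + 1, Cross (f j))) [Suc m..<n]"
    using Suc.hyps(2) by (intro Suc.hyps(1)) simp
  ultimately show ?case
    unfolding upt list.map row_crossings.simps by argo
qed simp

lemma resolve_free_diagram:
  "resolve a (free_diagram k n) = [(0, Cap), (2, Cap)] @ twist 1 (map (\<lambda>i. a (Column i)) [0..<k])
     @ row 1 (map (\<lambda>j. a (Row j)) [0..<n]) @ [(0, Cup), (0, Cup)]"
  using row_crossings_upt[of 0 "\<lambda>j. a (Row j)" n]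
  by (simp add: resolve_def free_diagram_def row_def twist_def comp_def eval_nat_numeral)

text \<open>A vanishing twist lets the other one unwind; conversely, colourings detect knotting when
  both twists are nonzero, which is where the parities enter. The row must be nonempty to be
  turned.\<close>

lemma is_unknot_free_diagram_iff:
  assumes "even k" "even n" "n > 0"
  shows "is_unknot (resolve a (free_diagram k n)) \<longleftrightarrow>
    net_twist (map (\<lambda>i. a (Column i)) [0..<k]) = 0 \<or> net_twist (map (\<lambda>j. a (Row j)) [0..<n]) = 0"
    (is "is_unknot ?D \<longleftrightarrow> net_twist ?v = 0 \<or> net_twist ?w = 0")
proof -
  have equiv: "tangle_equiv 0 ?D (double_twist ?v ?w)"
    unfolding resolve_free_diagram using assms by (intro double_twist_equiv_row) simp
  show ?thesis
  proof
    assume "net_twist ?v = 0 \<or> net_twist ?w = 0"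
    then have "tangle_equiv 0 (double_twist ?v ?w) circle"
      using double_twist_unknot_column double_twist_unknot_row by blast
    with equiv show "is_unknot ?D"
      by (intro is_unknotI) (rule tangle_equiv_trans)
  next
    assume "is_unknot ?D"
    then have "closed_diagram ?D" "diagram_equiv ?D circle"
      by (simp_all add: is_unknot_def)
    then have "diagram_equiv (double_twist ?v ?w) circle"
      using diagram_equiv_if_tangle_equiv[OF equiv] equivclp_sym equivclp_trans by metis
    then show "net_twist ?v = 0 \<or> net_twist ?w = 0"
      using double_twist_knotted[of ?v ?w] assms by auto
  qed
qed

section \<open>Assignments as pairs of subsets\<close>

lemma net_twist_upt:
  "net_twist (map f [0..<n]) = 2 * int (card {i \<in> {..<n}. f i = Falling}) - int n"
proof (induction n)
  case (Suc n)
  have "{i \<in> {..<Suc n}. f i = Falling} =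
      (if f n = Falling then insert n {i \<in> {..<n}. f i = Falling} else {i \<in> {..<n}. f i = Falling})"
    by (auto simp: less_Suc_eq)
  with Suc show ?case
    by (cases "f n") (auto simp: net_twist_def)
qed simp

text \<open>An assignment is encoded by its falling crossings in the column and in the row; the
  inverse is restricted to the crossings, as assignments are extensional functions.\<close>

lemma bij_betw_assignments_free_diagram:
  "bij_betw (\<lambda>a. ({i \<in> {..<k}. a (Column i) = Falling}, {j \<in> {..<n}. a (Row j) = Falling}))
     (assignments (free_diagram k n)) (Pow {..<k} \<times> Pow {..<n})"
proof (rule bij_betw_byWitness[where f' = "\<lambda>(A, B). \<lambda>c \<in> crossings (free_diagram k n).
      if c \<in> Column ` A \<union> Row ` B then Falling else Rising"])
  show "\<forall>a\<in>assignments (free_diagram k n). (\<lambda>(A, B). \<lambda>c \<in> crossings (free_diagram k n).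
      if c \<in> Column ` A \<union> Row ` B then Falling else Rising)
      ({i \<in> {..<k}. a (Column i) = Falling}, {j \<in> {..<n}. a (Row j) = Falling}) = a"
  proof
    fix a
    assume "a \<in> assignments (free_diagram k n)"
    moreover have "Rising = a c \<longleftrightarrow> a c \<noteq> Falling" for c
      by (cases "a c") auto
    ultimately show "(\<lambda>(A, B). \<lambda>c \<in> crossings (free_diagram k n).
      if c \<in> Column ` A \<union> Row ` B then Falling else Rising)
      ({i \<in> {..<k}. a (Column i) = Falling}, {j \<in> {..<n}. a (Row j) = Falling}) = a"
      by (intro ext) (auto simp: assignments_def crossings_free_diagram PiE_def extensional_def)
  qed
qed (auto simp: assignments_def crossings_free_diagram split: if_splits)

text \<open>Inclusion-exclusion: the pairs satisfying both conditions form a product and are counted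
  twice.\<close>

lemma card_product_subsets:
  assumes "finite S" "finite T"
  shows "int (card {(A, B). A \<subseteq> S \<and> B \<subseteq> T \<and> (card A = p \<or> card B = q)})
    = 2 ^ card S * int (card T choose q) + 2 ^ card T * int (card S choose p)
      - int (card T choose q) * int (card S choose p)"
proof -
  let ?X = "{A. A \<subseteq> S \<and> card A = p}" and ?Y = "{B. B \<subseteq> T \<and> card B = q}"
  have fin: "finite (?X \<times> Pow T)" "finite (Pow S \<times> ?Y)"
    using assms by (auto intro: finite_subset[of _ "Pow S"] finite_subset[of _ "Pow T"])
  have "{(A, B). A \<subseteq> S \<and> B \<subseteq> T \<and> (card A = p \<or> card B = q)} = ?X \<times> Pow T \<union> Pow S \<times> ?Y"
    by auto
  moreover have "?X \<times> Pow T \<inter> Pow S \<times> ?Y = ?X \<times> ?Y"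
    by auto
  moreover have "card (?X \<times> Pow T) = (card S choose p) * 2 ^ card T"
    "card (Pow S \<times> ?Y) = 2 ^ card S * (card T choose q)"
    "card (?X \<times> ?Y) = (card S choose p) * (card T choose q)"
    using assms by (simp_all add: card_cartesian_product n_subsets card_Pow)
  ultimately show ?thesis
    using arg_cong[OF card_Un_Int[OF fin], of int] by (simp add: algebra_simps)
qed

theorem theorem5p11:
  fixes k n :: nat
  assumes "k > 0" and "even k" and "n > 0" and "even n"
  shows "int (card {a \<in> assignments (free_diagram k n). is_unknot (resolve a (free_diagram k n))})
    = 2 ^ k * int (n choose (n div 2)) + 2 ^ n * int (k choose (k div 2))
      - int (n choose (n div 2)) * int (k choose (k div 2))"
proof -
  let ?f = "\<lambda>a. ({i \<in> {..<k}. a (Column i) = Falling}, {j \<in> {..<n}. a (Row j) = Falling})"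
  let ?U = "{a \<in> assignments (free_diagram k n). is_unknot (resolve a (free_diagram k n))}"
  let ?S = "{(A, B). A \<subseteq> {..<k} \<and> B \<subseteq> {..<n} \<and> (card A = k div 2 \<or> card B = n div 2)}"
  \<comment> \<open>Zero net twist means that exactly half of the crossings are falling.\<close>
  have balanced: "2 * int c - int m = 0 \<longleftrightarrow> c = m div 2" if "even m" for c m :: nat
    using that by presburger
  have unknot: "is_unknot (resolve a (free_diagram k n)) \<longleftrightarrow>
      card (fst (?f a)) = k div 2 \<or> card (snd (?f a)) = n div 2" for a
    unfolding is_unknot_free_diagram_iff[OF assms(2,4,3)] net_twist_upt
    using balanced assms by simp
  have bij: "bij_betw ?f (assignments (free_diagram k n)) (Pow {..<k} \<times> Pow {..<n})"
    by (rule bij_betw_assignments_free_diagram)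
  have "?S = {x \<in> Pow {..<k} \<times> Pow {..<n}. card (fst x) = k div 2 \<or> card (snd x) = n div 2}"
    by auto
  also have "\<dots> = {x \<in> ?f ` assignments (free_diagram k n).
      card (fst x) = k div 2 \<or> card (snd x) = n div 2}"
    using bij by (simp only: bij_betw_def)
  also have "\<dots> = ?f ` ?U"
    by (simp only: unknot) blast
  finally have "?S = ?f ` ?U" .
  moreover have "inj_on ?f ?U"
    using bij_betw_imp_inj_on[OF bij] by (rule inj_on_subset) simp
  ultimately have "card ?U = card ?S"
    by (simp only: card_image)
  then show ?thesis
    using card_product_subsets[of "{..<k}" "{..<n}" "k div 2" "n div 2"] by simp
qed

end
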